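(* Let $1<p<\infty$. The Kalton-Peck map $\mathscr K$ on $L_p=L_p(\Sigma,\mu)$, defined by $\mathscr K(x)=x\log\frac{|x|}{\|x\|_p}$ (with $\mathscr K(0)=0$), is super disjointly singular.
   Context: $(\Sigma,\mu)$ is a $\sigma$-finite measure space, $L_0$ is the space of measurable scalar functions on it, and $L_p(\Sigma,\mu)$ is infinite-dimensional. The convention $x(t)\log(|x(t)|/\|x\|_p)=0$ is used where $x(t)=0$. $\mathscr K$ is an $L_\infty$-centralizer on $L_p$, i.e. a homogeneous map $\Omega:L_p\to L_0$ such that $\|\Omega(fx)-f\Omega(x)\|_p\le C\|f\|_\infty\|x\|_p$ for some $C$ and all $f\in L_\infty$, $x\in L_p$. For a centralizer $\Omega$ on a Köthe function space $\mathcal K$ (here $\mathcal K=L_p$), the modulus of superdisjoint singularity is $$\psi_\Omega(n)=\inf_{E_n}\ \inf_L\ \sup\{\|\Omega x-Lx\|_{\mathcal K}:x\in E_n,\ \|x\|\le1\},$$ where $E_n$ runs over all $n$-dimensional subspaces of $\mathcal K$ generated by disjointly supported vectors and $L:E_n\to L_0$ runs over all linear maps (the norm is taken as $+\infty$ when $\Omega x-Lx\notin\mathcal K$). $\Omega$ is super disjointly singular if $\lim_{n\to\infty}\psi_\Omega(n)=+\infty$ (equivalently, if all ultrapowers of $\Omega$ are disjointly singular, i.e. not trivial on any infinite-dimensional subspace generated by a disjoint sequence). *)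

theory Defs
  imports "HOL-Analysis.Analysis" "HOL-Probability.Essential_Supremum"
begin

text \<open>
  Elements of \<open>L\<^sub>0\<close>, \<open>L\<^sub>p\<close> and \<open>L\<^sub>\<infinity>\<close> are represented by measurable functions, and functions that
  agree almost everywhere are identified: every notion below is invariant under that
  identification, and equations between elements of \<open>L\<^sub>0\<close> are stated almost everywhere.

  The scalar field is a type \<open>'k\<close> of sort \<open>{real_normed_field, euclidean_space}\<close>, which covers
  exactly the real and the complex scalars (up to isomorphism), so that both cases are treated
  at once.
\<close>

definition L0 :: "'a measure \<Rightarrow> ('a \<Rightarrow> 'k::{real_normed_field,euclidean_space}) set" where
  "L0 M = borel_measurable M"

definition Lp :: "'a measure \<Rightarrow> real \<Rightarrow> ('a \<Rightarrow> 'k::{real_normed_field,euclidean_space}) set" where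
  "Lp M p = {x \<in> L0 M. integrable M (\<lambda>t. norm (x t) powr p)}"

definition Lp_norm :: "'a measure \<Rightarrow> real \<Rightarrow> ('a \<Rightarrow> 'k::{real_normed_field,euclidean_space}) \<Rightarrow> real" where
  "Lp_norm M p x = (\<integral>t. norm (x t) powr p \<partial>M) powr (1 / p)"

definition Lp_enorm :: "'a measure \<Rightarrow> real \<Rightarrow> ('a \<Rightarrow> 'k::{real_normed_field,euclidean_space}) \<Rightarrow> ennreal" where
  "Lp_enorm M p x = (if x \<in> Lp M p then ennreal (Lp_norm M p x) else \<infinity>)"

definition Linf_enorm :: "'a measure \<Rightarrow> ('a \<Rightarrow> 'k::{real_normed_field,euclidean_space}) \<Rightarrow> ennreal" where
  "Linf_enorm M f = esssup M (\<lambda>t. ennreal (norm (f t)))"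

definition Linf :: "'a measure \<Rightarrow> ('a \<Rightarrow> 'k::{real_normed_field,euclidean_space}) set" where
  "Linf M = {f \<in> L0 M. Linf_enorm M f < \<infinity>}"

definition lin_indep_ae :: "'a measure \<Rightarrow> nat \<Rightarrow> (nat \<Rightarrow> 'a \<Rightarrow> 'k::{real_normed_field,euclidean_space}) \<Rightarrow> bool" where
  "lin_indep_ae M n u \<longleftrightarrow>
     (\<forall>c. (AE t in M. (\<Sum>i<n. c i * u i t) = 0) \<longrightarrow> (\<forall>i<n. c i = 0))"

definition span_ae :: "'a measure \<Rightarrow> nat \<Rightarrow> (nat \<Rightarrow> 'a \<Rightarrow> 'k::{real_normed_field,euclidean_space}) \<Rightarrow> ('a \<Rightarrow> 'k) set" where
  "span_ae M n u = {x \<in> L0 M. \<exists>c. AE t in M. x t = (\<Sum>i<n. c i * u i t)}"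

definition infinite_dimensional_ae :: "'a measure \<Rightarrow> ('a \<Rightarrow> 'k::{real_normed_field,euclidean_space}) set \<Rightarrow> bool" where
  "infinite_dimensional_ae M S \<longleftrightarrow> (\<forall>n. \<exists>u. (\<forall>i<n. u i \<in> S) \<and> lin_indep_ae M n u)"

text \<open>
  The \<open>n\<close>-dimensional subspaces of \<open>L\<^sub>p\<close> generated by disjointly supported vectors. A generating
  family of pairwise disjoint vectors becomes a basis once its zero members are dropped, so the
  family may be taken to have exactly \<open>n\<close> linearly independent members.
\<close>

definition disjoint_subspaces :: "'a measure \<Rightarrow> real \<Rightarrow> nat \<Rightarrow> ('a \<Rightarrow> 'k::{real_normed_field,euclidean_space}) set set" where
  "disjoint_subspaces M p n =
     {span_ae M n u | u.
        (\<forall>i<n. u i \<in> Lp M p) \<and>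
        (\<forall>i<n. \<forall>j<n. i \<noteq> j \<longrightarrow> (AE t in M. u i t = 0 \<or> u j t = 0)) \<and>
        lin_indep_ae M n u}"

text \<open>
  The maps on representatives that induce a linear map from (the classes of) \<open>E\<close> to \<open>L\<^sub>0\<close>.
\<close>

definition linear_maps_L0 :: "'a measure \<Rightarrow> ('a \<Rightarrow> 'k::{real_normed_field,euclidean_space}) set \<Rightarrow> (('a \<Rightarrow> 'k) \<Rightarrow> 'a \<Rightarrow> 'k) set" where
  "linear_maps_L0 M E =
     {L. (\<forall>x\<in>E. L x \<in> L0 M) \<and>
         (\<forall>x\<in>E. \<forall>y\<in>E. (AE t in M. x t = y t) \<longrightarrow> (AE t in M. L x t = L y t)) \<and>
         (\<forall>x\<in>E. \<forall>y\<in>E. AE t in M. L (\<lambda>s. x s + y s) t = L x t + L y t) \<and>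
         (\<forall>a. \<forall>x\<in>E. AE t in M. L (\<lambda>s. a * x s) t = a * L x t)}"

definition homogeneous_map :: "'a measure \<Rightarrow> real \<Rightarrow> (('a \<Rightarrow> 'k::{real_normed_field,euclidean_space}) \<Rightarrow> 'a \<Rightarrow> 'k) \<Rightarrow> bool" where
  "homogeneous_map M p \<Omega> \<longleftrightarrow>
     (\<forall>x\<in>Lp M p. \<Omega> x \<in> L0 M) \<and>
     (\<forall>x\<in>Lp M p. \<forall>y\<in>Lp M p. (AE t in M. x t = y t) \<longrightarrow> (AE t in M. \<Omega> x t = \<Omega> y t)) \<and>
     (\<forall>a. \<forall>x\<in>Lp M p. AE t in M. \<Omega> (\<lambda>s. a * x s) t = a * \<Omega> x t)"

definition centralizer :: "'a measure \<Rightarrow> real \<Rightarrow> (('a \<Rightarrow> 'k::{real_normed_field,euclidean_space}) \<Rightarrow> 'a \<Rightarrow> 'k) \<Rightarrow> bool" where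
  "centralizer M p \<Omega> \<longleftrightarrow>
     homogeneous_map M p \<Omega> \<and>
     (\<exists>C::real. \<forall>f\<in>Linf M. \<forall>x\<in>Lp M p.
        Lp_enorm M p (\<lambda>t. \<Omega> (\<lambda>s. f s * x s) t - f t * \<Omega> x t)
          \<le> ennreal C * Linf_enorm M f * Lp_enorm M p x)"

definition superdisjoint_modulus ::
  "'a measure \<Rightarrow> real \<Rightarrow> (('a \<Rightarrow> 'k::{real_normed_field,euclidean_space}) \<Rightarrow> 'a \<Rightarrow> 'k) \<Rightarrow> nat \<Rightarrow> ennreal" where
  "superdisjoint_modulus M p \<Omega> n =
     (INF E\<in>disjoint_subspaces M p n. INF L\<in>linear_maps_L0 M E.
        SUP x\<in>{x \<in> E. Lp_norm M p x \<le> 1}. Lp_enorm M p (\<lambda>t. \<Omega> x t - L x t))"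

definition super_disjointly_singular ::
  "'a measure \<Rightarrow> real \<Rightarrow> (('a \<Rightarrow> 'k::{real_normed_field,euclidean_space}) \<Rightarrow> 'a \<Rightarrow> 'k) \<Rightarrow> bool" where
  "super_disjointly_singular M p \<Omega> \<longleftrightarrow>
     centralizer M p \<Omega> \<and> superdisjoint_modulus M p \<Omega> \<longlonglongrightarrow> \<infinity>"

text \<open>
  The conventions \<open>x(t) log(|x(t)| / \<parallel>x\<parallel>) = 0\<close> where \<open>x(t) = 0\<close>, and value \<open>0\<close> at the zero
  vector, hold without a case distinction: in the former case the vector factor vanishes, and in
  the latter \<open>\<parallel>x\<parallel> = 0\<close>, so that the logarithm is \<open>ln (_ / 0) = ln 0 = 0\<close>.
\<close>

definition kalton_peck :: "'a measure \<Rightarrow> real \<Rightarrow> ('a \<Rightarrow> 'k::{real_normed_field,euclidean_space}) \<Rightarrow> 'a \<Rightarrow> 'k" where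
  "kalton_peck M p x = (\<lambda>t. ln (norm (x t) / Lp_norm M p x) *\<^sub>R x t)"

end

theory Submission
  imports Defs "HOL-Real_Asymp.Real_Asymp"
begin

text \<open>
  That the Kalton-Peck map \<open>\<K>\<close> is a centralizer comes from the identity
  \<open>\<K>(f x) - f \<K>(x) = f x (ln |f| - ln (\<parallel>f x\<parallel> / \<parallel>x\<parallel>))\<close>: after scaling to \<open>\<parallel>f\<parallel>\<^sub>\<infinity> = 1\<close> the
  boundedness of \<open>s ln s\<close> on the unit interval controls both terms
  (\<open>kalton_peck_commutator_le\<close>, \<open>centralizer_kalton_peck\<close>).

  For the modulus, let \<open>u\<^sub>1, \<dots>, u\<^sub>n\<close> be disjoint unit vectors, let \<open>L\<close> be linear on their span, and
  suppose that \<open>\<K> - L\<close> is bounded by \<open>B\<close> on the unit ball of the span. For every choice of signs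
  \<open>\<epsilon>\<close> the vector \<open>x\<^sub>\<epsilon> = n powr (- 1 / p) (\<epsilon>\<^sub>1 u\<^sub>1 + \<dots> + \<epsilon>\<^sub>n u\<^sub>n)\<close> has norm 1, and on the support of
  \<open>u\<^sub>i\<close>
    \<open>\<epsilon>\<^sub>i \<K>(x\<^sub>\<epsilon>) = n powr (- 1 / p) (\<K>(u\<^sub>i) - (ln n / p) u\<^sub>i)\<close>,
  while the average of \<open>\<epsilon>\<^sub>i L(x\<^sub>\<epsilon>)\<close> over all signs is \<open>n powr (- 1 / p) L(u\<^sub>i)\<close>. So the average of
  \<open>\<epsilon>\<^sub>i (\<K>(x\<^sub>\<epsilon>) - L(x\<^sub>\<epsilon>))\<close> there is \<open>n powr (- 1 / p) (\<K>(u\<^sub>i) - L(u\<^sub>i) - (ln n / p) u\<^sub>i)\<close>. By Jensen's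
  inequality, summed over the disjoint supports, the restrictions of
  \<open>\<K>(u\<^sub>i) - L(u\<^sub>i) - (ln n / p) u\<^sub>i\<close> to the support of \<open>u\<^sub>i\<close> have norms whose \<open>p\<close>-th powers, averaged
  over \<open>i\<close>, are at most \<open>B powr p\<close>. The same holds for \<open>\<K>(u\<^sub>i) - L(u\<^sub>i)\<close>, because \<open>u\<^sub>i\<close> is in the unit
  ball. The difference of the two is \<open>(ln n / p) u\<^sub>i\<close>, of norm \<open>ln n / p\<close> for every \<open>i\<close>, so that
  \<open>ln n / p \<le> 4 B\<close>, and \<open>B\<close> grows at least like \<open>ln n / (4 p)\<close>
  (\<open>random_signs_pointwise\<close>, \<open>kalton_peck_distance_to_linear\<close>).

  Averaging on the support of \<open>u\<^sub>i\<close> instead of taking the norm of the whole random sum is what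
  makes \<open>p > 2\<close> no harder than \<open>p \<le> 2\<close>: the images \<open>L(u\<^sub>i)\<close> may overlap, and a random sum of
  overlapping unit vectors can have norm of order \<open>sqrt n\<close>, which for \<open>p > 2\<close> would hide the main
  term of order \<open>n powr (1 / p) * ln n\<close>.
\<close>

section \<open>Inequalities for real powers\<close>

text \<open>
  In place of the triangle inequality of \<open>L\<^sub>p\<close> this pointwise form can be integrated directly; it
  costs only a constant factor, which is harmless both for the centralizer estimate and for the
  growth of the modulus.
\<close>

lemma powr_add_le:
  fixes a b p :: real
  assumes "0 \<le> a" "0 \<le> b" "0 \<le> p"
  shows "(a + b) powr p \<le> 2 powr p * (a powr p + b powr p)"
proof -
  have "(a + b) powr p \<le> (2 * max a b) powr p"
    using assms by (intro powr_mono2) auto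
  also have "\<dots> = 2 powr p * max a b powr p"
    using assms by (subst powr_mult) auto
  also have "\<dots> \<le> 2 powr p * (a powr p + b powr p)"
    by (intro mult_left_mono) (auto simp: max_def)
  finally show ?thesis .
qed

lemma convex_on_powr_nonneg:
  fixes p :: real
  assumes "1 \<le> p"
  shows "convex_on {0..} (\<lambda>x. x powr p)"
proof -
  have scale: "(t * x) powr p \<le> t * x powr p" if "0 < t" "t < 1" "0 \<le> x" for t x :: real
  proof -
    have "t powr p \<le> t powr 1"
      using that assms by (intro powr_mono') auto
    then show ?thesis
      using that by (auto simp: powr_mult intro!: mult_right_mono)
  qed
  show ?thesis
  proof (rule convex_onI)
    fix t x y :: real
    assume t: "0 < t" "t < 1" and xy: "x \<in> {0..}" "y \<in> {0..}"
    show "((1 - t) *\<^sub>R x + t *\<^sub>R y) powr p \<le> (1 - t) * x powr p + t * y powr p"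
    proof (cases "x = 0 \<or> y = 0")
      case True
      then show ?thesis
        using scale[of t y] scale[of "1 - t" x] t xy assms by auto
    next
      case False
      then show ?thesis
        using convex_onD[OF powr_convex[OF assms], of t x y] t xy by auto
    qed
  qed auto
qed

text \<open>
  Jensen's inequality for the uniform distribution on \<open>S\<close>; it bounds the average over the choices
  of signs.
\<close>

lemma powr_norm_sum_le:
  fixes y :: "'b \<Rightarrow> 'k::real_normed_vector"
  assumes "finite S" "S \<noteq> {}" "1 \<le> p"
  shows "(norm (\<Sum>s\<in>S. y s) / card S) powr p \<le> (\<Sum>s\<in>S. norm (y s) powr p) / card S"
proof -
  have "norm (\<Sum>s\<in>S. y s) / card S \<le> (\<Sum>s\<in>S. norm (y s)) / card S"
    by (intro divide_right_mono norm_sum) auto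
  then have "(norm (\<Sum>s\<in>S. y s) / card S) powr p \<le> ((\<Sum>s\<in>S. norm (y s)) / card S) powr p"
    using assms by (intro powr_mono2) auto
  also have "\<dots> = (\<Sum>s\<in>S. (1 / card S) *\<^sub>R norm (y s)) powr p"
    by (simp add: sum_divide_distrib)
  also have "\<dots> \<le> (\<Sum>s\<in>S. (1 / card S) * norm (y s) powr p)"
    using assms by (intro convex_on_sum[OF _ _ convex_on_powr_nonneg]) auto
  also have "\<dots> = (\<Sum>s\<in>S. norm (y s) powr p) / card S"
    by (simp add: sum_divide_distrib)
  finally show ?thesis .
qed

lemma mult_abs_ln_le_1:
  fixes s :: real
  assumes "0 \<le> s" "s \<le> 1"
  shows "s * \<bar>ln s\<bar> \<le> 1"
proof (cases "s = 0")
  case False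
  with assms have s: "0 < s" by simp
  have "\<bar>ln s\<bar> = ln (1 / s)"
    using s assms by (simp add: ln_div)
  also have "\<dots> \<le> 1 / s - 1"
    using s by (intro ln_le_minus_one) auto
  finally have "s * \<bar>ln s\<bar> \<le> s * (1 / s - 1)"
    using s by (intro mult_left_mono) auto
  then show ?thesis
    using s by (simp add: algebra_simps)
qed simp

section \<open>The norm of \<open>L\<^sub>p\<close>\<close>

lemma Lp_norm_nonneg [simp]: "0 \<le> Lp_norm M p x"
  by (simp add: Lp_norm_def)

lemma Lp_norm_powr:
  assumes "0 < p"
  shows "Lp_norm M p x powr p = (\<integral>t. norm (x t) powr p \<partial>M)"
  using assms by (simp add: Lp_norm_def powr_powr)

lemma Lp_norm_cong_AE:
  assumes "x \<in> L0 M" "y \<in> L0 M" "AE t in M. x t = y t"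
  shows "Lp_norm M p x = Lp_norm M p y"
proof -
  have [measurable]: "x \<in> borel_measurable M" "y \<in> borel_measurable M"
    using assms by (auto simp: L0_def)
  have "(\<integral>t. norm (x t) powr p \<partial>M) = (\<integral>t. norm (y t) powr p \<partial>M)"
    by (rule integral_cong_AE) (use assms(3) in auto)
  then show ?thesis
    by (simp add: Lp_norm_def)
qed

lemma Lp_norm_cmult:
  assumes "0 < p"
  shows "Lp_norm M p (\<lambda>t. a * x t) = norm a * Lp_norm M p x"
  using assms by (simp add: Lp_norm_def norm_mult powr_mult powr_powr integral_nonneg_AE)

lemma Lp_cmult:
  assumes "x \<in> Lp M p"
  shows "(\<lambda>t. a * x t) \<in> Lp M p"
  using assms by (auto simp: Lp_def L0_def norm_mult powr_mult)

lemma Lp_norm_eq_0_iff: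
  assumes "x \<in> Lp M p" "0 < p"
  shows "Lp_norm M p x = 0 \<longleftrightarrow> (AE t in M. x t = 0)"
proof -
  have "Lp_norm M p x = 0 \<longleftrightarrow> (\<integral>t. norm (x t) powr p \<partial>M) = 0"
    by (simp add: Lp_norm_def)
  also have "\<dots> \<longleftrightarrow> (AE t in M. norm (x t) powr p = 0)"
    using assms by (intro integral_nonneg_eq_0_iff_AE) (auto simp: Lp_def)
  finally show ?thesis
    by simp
qed

lemma Lp_enorm_le:
  assumes "F \<in> L0 M" "AE t in M. norm (F t) powr p \<le> h t" "integrable M h"
    and "(\<integral>t. h t \<partial>M) \<le> B powr p" "0 \<le> B" "0 < p"
  shows "Lp_enorm M p F \<le> ennreal B"
proof -
  have [measurable]: "F \<in> borel_measurable M"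
    using assms by (auto simp: L0_def)
  have int: "integrable M (\<lambda>t. norm (F t) powr p)"
    by (rule Bochner_Integration.integrable_bound[OF assms(3)]) (use assms(2) in auto)
  have "(\<integral>t. norm (F t) powr p \<partial>M) \<le> (\<integral>t. h t \<partial>M)"
    by (rule integral_mono_AE) (use int assms in auto)
  then have "Lp_norm M p F powr p \<le> B powr p"
    using assms by (simp add: Lp_norm_powr)
  then have "Lp_norm M p F \<le> B"
    using assms by (metis Lp_norm_nonneg linorder_not_less powr_less_mono2)
  then show ?thesis
    using assms int by (auto simp: Lp_enorm_def Lp_def intro: ennreal_leI)
qed

section \<open>The Kalton-Peck map is a centralizer\<close>

lemma Linf_bound:
  assumes "f \<in> Linf M"
  obtains N where "0 \<le> N" "Linf_enorm M f = ennreal N" "AE t in M. norm (f t) \<le> N"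
proof
  show "0 \<le> enn2real (Linf_enorm M f)"
    by simp
  show eq: "Linf_enorm M f = ennreal (enn2real (Linf_enorm M f))"
    using assms by (auto simp: Linf_def)
  have "AE t in M. ennreal (norm (f t)) \<le> Linf_enorm M f"
    unfolding Linf_enorm_def by (rule esssup_AE)
  then show "AE t in M. norm (f t) \<le> enn2real (Linf_enorm M f)"
    by (subst (asm) eq) (auto simp: ennreal_le_iff)
qed

lemma Lp_mult_bounded:
  assumes f: "f \<in> L0 M" "AE t in M. norm (f t) \<le> N" and x: "x \<in> Lp M p" and "0 < p" "0 \<le> N"
  shows "(\<lambda>t. f t * x t) \<in> Lp M p" "Lp_norm M p (\<lambda>t. f t * x t) \<le> N * Lp_norm M p x"
proof -
  have [measurable]: "f \<in> borel_measurable M" "x \<in> borel_measurable M"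
    using assms by (auto simp: L0_def Lp_def)
  have le: "AE t in M. norm (f t * x t) powr p \<le> N powr p * norm (x t) powr p"
    using f(2)
  proof eventually_elim
    case (elim t)
    then have "norm (f t * x t) powr p \<le> (N * norm (x t)) powr p"
      using assms by (intro powr_mono2) (auto simp: norm_mult intro: mult_right_mono)
    then show ?case
      using assms by (simp add: powr_mult)
  qed
  have int: "integrable M (\<lambda>t. N powr p * norm (x t) powr p)"
    using x by (auto simp: Lp_def)
  have "Lp_enorm M p (\<lambda>t. f t * x t) \<le> ennreal (N * Lp_norm M p x)"
    by (rule Lp_enorm_le[OF _ le int])
      (use assms in \<open>auto simp: L0_def powr_mult Lp_norm_powr\<close>)
  then show "(\<lambda>t. f t * x t) \<in> Lp M p" "Lp_norm M p (\<lambda>t. f t * x t) \<le> N * Lp_norm M p x"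
    using assms by (auto simp: Lp_enorm_def top_unique split: if_splits)
qed

lemma kalton_peck_measurable:
  assumes "x \<in> L0 M"
  shows "kalton_peck M p x \<in> L0 M"
proof -
  have [measurable]: "x \<in> borel_measurable M"
    using assms by (simp add: L0_def)
  show ?thesis
    by (simp add: L0_def kalton_peck_def)
qed

lemma homogeneous_kalton_peck:
  assumes "0 < p"
  shows "homogeneous_map M p (kalton_peck M p)"
  unfolding homogeneous_map_def
proof (intro conjI ballI impI allI)
  fix x y :: "'a \<Rightarrow> 'b" and a :: 'b
  assume x: "x \<in> Lp M p"
  then show "kalton_peck M p x \<in> L0 M"
    by (intro kalton_peck_measurable) (simp add: Lp_def)
  show "AE t in M. kalton_peck M p (\<lambda>s. a * x s) t = a * kalton_peck M p x t"
    using assms by (cases "a = 0") (auto simp: kalton_peck_def Lp_norm_cmult norm_mult)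
  assume y: "y \<in> Lp M p" and eq: "AE t in M. x t = y t"
  have "Lp_norm M p x = Lp_norm M p y"
    using x y eq by (intro Lp_norm_cong_AE) (auto simp: Lp_def)
  with eq show "AE t in M. kalton_peck M p x t = kalton_peck M p y t"
    by (auto simp: kalton_peck_def)
qed

text \<open>
  The norm of \<open>x\<close> cancels up to a constant: where \<open>f\<close> and \<open>x\<close> do not vanish,
  \<open>\<K>(f x) - f \<K>(x) = f x (ln (|f| / N) - ln (\<parallel>f x\<parallel> / (N \<parallel>x\<parallel>)))\<close> for every \<open>N > 0\<close>. For
  \<open>N = \<parallel>f\<parallel>\<^sub>\<infinity>\<close> both arguments of the logarithm lie in the unit interval, where \<open>s |ln s| \<le> 1\<close>;
  the first logarithm is absorbed by \<open>|f|\<close> pointwise and the second, a constant, by \<open>\<parallel>f x\<parallel>\<close>.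
\<close>

lemma kalton_peck_commutator_le:
  fixes f x :: "'a \<Rightarrow> 'k::{real_normed_field,euclidean_space}"
  assumes "norm (f t) \<le> N" "0 < N" "0 < Lp_norm M p x" "0 < Lp_norm M p (\<lambda>s. f s * x s)"
  shows "norm (kalton_peck M p (\<lambda>s. f s * x s) t - f t * kalton_peck M p x t)
    \<le> N * norm (x t)
      + \<bar>ln (Lp_norm M p (\<lambda>s. f s * x s) / (N * Lp_norm M p x))\<bar> * norm (f t * x t)"
proof (cases "f t * x t = 0")
  case True
  then show ?thesis
    using assms by (auto simp: kalton_peck_def)
next
  case False
  define X where "X = Lp_norm M p x"
  define Y where "Y = Lp_norm M p (\<lambda>s. f s * x s)"
  have pos: "0 < X" "0 < Y" "0 < norm (f t)" "0 < norm (x t)"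
    using False assms by (auto simp: X_def Y_def)
  have "kalton_peck M p (\<lambda>s. f s * x s) t - f t * kalton_peck M p x t
    = (ln (norm (f t) / N) - ln (Y / (N * X))) *\<^sub>R (f t * x t)"
    using pos assms(2)
    by (simp add: kalton_peck_def X_def[symmetric] Y_def[symmetric] norm_mult ln_div ln_mult
        flip: scaleR_left_diff_distrib)
  then have "norm (kalton_peck M p (\<lambda>s. f s * x s) t - f t * kalton_peck M p x t)
    \<le> (\<bar>ln (norm (f t) / N)\<bar> + \<bar>ln (Y / (N * X))\<bar>) * norm (f t * x t)"
    by (auto intro!: mult_right_mono)
  also have "\<dots> = (norm (f t) / N * \<bar>ln (norm (f t) / N)\<bar>) * (N * norm (x t))
      + \<bar>ln (Y / (N * X))\<bar> * norm (f t * x t)"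
    using assms(2) by (simp add: norm_mult field_simps)
  also have "\<dots> \<le> 1 * (N * norm (x t)) + \<bar>ln (Y / (N * X))\<bar> * norm (f t * x t)"
    using assms(1,2) by (intro add_right_mono mult_right_mono mult_abs_ln_le_1) auto
  finally show ?thesis
    by (simp add: X_def Y_def)
qed

lemma centralizer_kalton_peck:
  assumes "1 \<le> p"
  shows "centralizer M p
    (kalton_peck M p :: ('a \<Rightarrow> 'k::{real_normed_field,euclidean_space}) \<Rightarrow> 'a \<Rightarrow> 'k)"
  unfolding centralizer_def
proof (intro conjI exI[of _ 4] ballI)
  show "homogeneous_map M p (kalton_peck M p :: ('a \<Rightarrow> 'k) \<Rightarrow> _)"
    using assms by (intro homogeneous_kalton_peck) auto
next
  fix f x :: "'a \<Rightarrow> 'k"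
  assume f: "f \<in> Linf M" and x: "x \<in> Lp M p"
  obtain N where N: "0 \<le> N" "Linf_enorm M f = ennreal N" "AE t in M. norm (f t) \<le> N"
    using Linf_bound[OF f] .
  define X where "X = Lp_norm M p x"
  define Y where "Y = Lp_norm M p (\<lambda>s. f s * x s)"
  have f0: "f \<in> L0 M" and x0: "x \<in> L0 M"
    using f x by (auto simp: Linf_def Lp_def)
  have [measurable]: "f \<in> borel_measurable M" "x \<in> borel_measurable M"
    using f0 x0 by (auto simp: L0_def)
  have fx: "(\<lambda>s. f s * x s) \<in> Lp M p" and Y_le: "Y \<le> N * X"
    using Lp_mult_bounded[OF f0 N(3) x _ N(1)] assms by (auto simp: X_def Y_def)
  let ?F = "\<lambda>t. kalton_peck M p (\<lambda>s. f s * x s) t - f t * kalton_peck M p x t"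
  have [measurable]: "kalton_peck M p (\<lambda>s. f s * x s) \<in> borel_measurable M"
    "kalton_peck M p x \<in> borel_measurable M"
    using kalton_peck_measurable[of x M p] kalton_peck_measurable[of "\<lambda>s. f s * x s" M p] x0 fx
    by (auto simp: L0_def Lp_def)
  have F: "?F \<in> L0 M"
    by (simp add: L0_def)
  have "Lp_enorm M p ?F \<le> ennreal (4 * N * X)"
  proof (cases "Y = 0")
    case True
    then have "AE t in M. f t * x t = 0"
      using Lp_norm_eq_0_iff[OF fx] assms by (simp add: Y_def)
    then have "AE t in M. norm (?F t) powr p \<le> 0"
      by eventually_elim (auto simp: kalton_peck_def)
    then show ?thesis
      using F N(1) assms by (intro Lp_enorm_le[where h = "\<lambda>_. 0"]) (auto simp: X_def)
  next
    case False
    then have "0 < Y"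
      by (simp add: Y_def less_le)
    with Y_le have "0 < N * X"
      by simp
    then have pos: "0 < N" "0 < X"
      using N(1) by (auto simp: X_def zero_less_mult_iff)
    define r where "r = \<bar>ln (Y / (N * X))\<bar>"
    define h where "h t = 2 powr p * (N powr p * norm (x t) powr p
      + r powr p * norm (f t * x t) powr p)" for t
    have "AE t in M. norm (?F t) powr p \<le> h t"
      using N(3)
    proof eventually_elim
      case (elim t)
      have "norm (?F t) powr p \<le> (N * norm (x t) + r * norm (f t * x t)) powr p"
        using kalton_peck_commutator_le[of f t N M p x] elim pos \<open>0 < Y\<close> assms
        by (intro powr_mono2) (auto simp: X_def Y_def r_def)
      also have "\<dots> \<le> 2 powr p * ((N * norm (x t)) powr p + (r * norm (f t * x t)) powr p)"
        using pos assms by (intro powr_add_le) (auto simp: r_def)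
      also have "\<dots> = h t"
        by (simp add: h_def powr_mult)
      finally show ?case .
    qed
    moreover have int: "integrable M (\<lambda>t. norm (x t) powr p)"
      "integrable M (\<lambda>t. norm (f t * x t) powr p)"
      using x fx by (auto simp: Lp_def)
    then have "integrable M h"
      unfolding h_def by (intro integrable_mult_right Bochner_Integration.integrable_add)
    moreover have "(\<integral>t. h t \<partial>M) \<le> (4 * N * X) powr p"
    proof -
      have "(\<integral>t. h t \<partial>M) = 2 powr p * (N powr p * X powr p + r powr p * Y powr p)"
        using int assms by (simp add: h_def X_def Y_def Lp_norm_powr)
      also have "\<dots> = 2 powr p * ((N * X) powr p + (r * Y) powr p)"
        by (simp add: powr_mult)
      also have "\<dots> \<le> 2 powr p * ((N * X) powr p + (N * X) powr p)"
      proof -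
        have "(Y / (N * X)) * r * (N * X) \<le> 1 * (N * X)"
          unfolding r_def using pos \<open>0 < Y\<close> Y_le by (intro mult_right_mono mult_abs_ln_le_1) auto
        then have "r * Y \<le> N * X"
          using pos by (simp add: mult.commute)
        then show ?thesis
          using \<open>0 < Y\<close> assms
          by (intro mult_left_mono add_left_mono powr_mono2) (auto simp: r_def)
      qed
      \<comment> \<open>One factor 2 of the constant 4 is the cost of \<open>powr_add_le\<close>, the other one bounds the
        two equal summands, as \<open>2 \<le> 2 powr p\<close>.\<close>
      also have "\<dots> = 2 powr p * (2 powr 1 * (N * X) powr p)"
        by simp
      also have "\<dots> \<le> 2 powr p * (2 powr p * (N * X) powr p)"
        using assms by (intro mult_left_mono mult_right_mono powr_mono) auto
      also have "\<dots> = (2 * (2 * (N * X))) powr p"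
        by (simp only: powr_mult)
      finally show ?thesis
        by (simp add: mult.assoc)
    qed
    ultimately show ?thesis
      using F pos assms by (intro Lp_enorm_le) auto
  qed
  also have "\<dots> = ennreal 4 * Linf_enorm M f * Lp_enorm M p x"
    using x N by (simp add: Lp_enorm_def X_def ennreal_mult)
  finally show "Lp_enorm M p ?F \<le> ennreal 4 * Linf_enorm M f * Lp_enorm M p x" .
qed

section \<open>Random signs\<close>

text \<open>
  The choices of signs on an index set \<open>A\<close> are encoded by the subsets \<open>S\<close> of \<open>A\<close> on which the sign is
  negative, so that averaging over all choices is averaging over \<open>Pow A\<close>.
\<close>

definition sign_of :: "nat set \<Rightarrow> nat \<Rightarrow> 'k::ring_1" where
  "sign_of S i = (if i \<in> S then - 1 else 1)"

lemma norm_sign_of [simp]: "norm (sign_of S i :: 'k::real_normed_div_algebra) = 1"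
  by (simp add: sign_of_def)

text \<open>
  Off the diagonal, changing the \<open>i\<close>-th sign is an involution that negates each term of the sum.
\<close>

lemma sum_sign_of_mult:
  assumes "finite A" "i \<in> A"
  shows "(\<Sum>S\<in>Pow A. sign_of S i * sign_of S j :: 'k::real_normed_field)
    = (if i = j then 2 ^ card A else 0)"
proof (cases "i = j")
  case True
  then show ?thesis
    using assms by (simp add: sign_of_def if_distrib card_Pow cong: if_cong)
next
  case False
  define s :: 'k where "s = (\<Sum>S\<in>Pow A. sign_of S i * sign_of S j)"
  define T where "T S = (if i \<in> S then S - {i} else insert i S)" for S
  have "s = (\<Sum>S\<in>Pow A. - (sign_of S i * sign_of S j))"
    unfolding s_def
    by (rule sum.reindex_bij_witness[of _ T T])
      (use assms False in \<open>auto simp: T_def sign_of_def\<close>)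
  also have "\<dots> = - s"
    by (simp add: s_def sum_negf)
  finally have "s + s = 0"
    by (rule eq_neg_iff_add_eq_0[THEN iffD1])
  then have "2 * s = 0"
    by (simp only: mult_2)
  then show ?thesis
    using False by (simp add: s_def)
qed

lemma disjoint_family_cases:
  fixes a :: "nat \<Rightarrow> 'k::zero" and n :: nat
  assumes "\<forall>i<n. \<forall>j<n. i \<noteq> j \<longrightarrow> a i = 0 \<or> a j = 0"
  obtains "\<And>i. i < n \<Longrightarrow> a i = 0"
    | i where "i < n" "a i \<noteq> 0" "\<And>j. j < n \<Longrightarrow> j \<noteq> i \<Longrightarrow> a j = 0"
  using assms by metis

lemma sum_lessThan_single:
  fixes f :: "nat \<Rightarrow> 'b::comm_monoid_add"
  assumes "i < n" "\<And>j. j < n \<Longrightarrow> j \<noteq> i \<Longrightarrow> f j = 0"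
  shows "(\<Sum>j<n. f j) = f i"
proof -
  have "(\<Sum>j<n. f j) = (\<Sum>j\<in>{i}. f j)"
    by (rule sum.mono_neutral_right) (use assms in auto)
  then show ?thesis
    by simp
qed

lemma powr_norm_disjoint_sum:
  fixes a c :: "nat \<Rightarrow> 'k::real_normed_field"
  assumes "\<forall>i<n. \<forall>j<n. i \<noteq> j \<longrightarrow> a i = 0 \<or> a j = 0"
  shows "norm (\<Sum>i<n. c i * a i) powr p = (\<Sum>i<n. norm (c i * a i) powr p)"
  using assms
proof (cases rule: disjoint_family_cases)
  case 1
  then show ?thesis by simp
next
  case (2 i)
  have "(\<Sum>j<n. c j * a j) = c i * a i"
    by (rule sum_lessThan_single) (use 2 in auto)
  moreover have "(\<Sum>j<n. norm (c j * a j) powr p) = norm (c i * a i) powr p"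
    by (rule sum_lessThan_single) (use 2 in auto)
  ultimately show ?thesis by simp
qed

text \<open>
  The heart of the lower bound, at a single point. Here \<open>a i\<close> and \<open>w i\<close> are the values of the
  \<open>i\<close>-th basis vector and of its image under a linear map, and \<open>\<Sum>i<n. b S i * a i\<close> is the value of
  the normalized vector with signs \<open>S\<close>. At most one \<open>a i\<close> is nonzero, and then the logarithm sees
  the normalizing factor \<open>n powr (- 1 / p)\<close> as the additive constant \<open>- ln n / p\<close>. Multiplying by
  the \<open>i\<close>-th sign and averaging over all signs removes the values \<open>w j\<close> with \<open>j \<noteq> i\<close>, and what is
  left is \<open>(ln |a i| a i - w i) - (ln n / p) a i\<close>, up to the normalizing factor. Hence
  \<open>(ln n / p) a i\<close> is the difference of two quantities that both measure the distance of the
  Kalton-Peck map to the linear map.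
\<close>

lemma random_signs_pointwise:
  fixes a w :: "nat \<Rightarrow> 'k::{real_normed_field,euclidean_space}"
  assumes disj: "\<forall>i<n. \<forall>j<n. i \<noteq> j \<longrightarrow> a i = 0 \<or> a j = 0"
    and n: "0 < n" and p: "1 \<le> p"
  defines "b \<equiv> \<lambda>S i. of_real (real n powr (- 1 / p)) * sign_of S i"
  shows "(\<Sum>i<n. (ln n / p * norm (a i)) powr p)
    \<le> 2 powr p * ((\<Sum>i<n. norm (ln (norm (a i)) *\<^sub>R a i - w i) powr p)
      + n / 2 ^ n * (\<Sum>S\<in>Pow {..<n}. norm (ln (norm (\<Sum>i<n. b S i * a i)) *\<^sub>R (\<Sum>i<n. b S i * a i)
          - (\<Sum>i<n. b S i * w i)) powr p))"
    (is "_ \<le> _ * (_ + _ * (\<Sum>S\<in>_. norm (?y S) powr p))")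
  using disj
proof (cases rule: disjoint_family_cases)
  case 1
  then have "(\<Sum>i<n. (ln n / p * norm (a i)) powr p) = 0"
    by simp
  also have "0 \<le> 2 powr p * ((\<Sum>i<n. norm (ln (norm (a i)) *\<^sub>R a i - w i) powr p)
      + n / 2 ^ n * (\<Sum>S\<in>Pow {..<n}. norm (?y S) powr p))"
    by (intro mult_nonneg_nonneg add_nonneg_nonneg sum_nonneg) auto
  finally show ?thesis .
next
  case (2 i)
  define q where "q = real n powr (- 1 / p)"
  define c where "c = ln n / p"
  define v where "v = ln (norm (a i)) *\<^sub>R a i - w i"
  \<comment> \<open>\<open>d\<close> and \<open>W S\<close> are the two parts of \<open>?y S\<close> with the factor \<open>q\<close> taken out and, in \<open>d\<close>, the
    \<open>i\<close>-th sign.\<close>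
  define d where "d = ln (norm (a i)) *\<^sub>R a i - c *\<^sub>R a i"
  define W where "W S = (\<Sum>j<n. sign_of S j * w j)" for S
  have q: "0 < q" "q powr p = 1 / n" "ln q = - c"
    using n p by (auto simp: q_def c_def powr_powr ln_powr powr_divide ln_div)
  have c0: "0 \<le> c"
    using n p by (simp add: c_def)
  have b: "b S j = of_real q * sign_of S j" for S j
    by (simp add: b_def q_def)
  define y where "y S = ?y S" for S
  have y: "y S = of_real q * (sign_of S i * d - W S)" for S
  proof -
    have x: "(\<Sum>j<n. b S j * a j) = b S i * a i"
      by (rule sum_lessThan_single) (use 2 in auto)
    have ln_x: "ln (norm (b S i * a i)) = ln (norm (a i)) - c"
      using q 2 by (simp add: b norm_mult ln_mult)
    have "?y S = (ln (norm (a i)) - c) *\<^sub>R (b S i * a i) - (\<Sum>j<n. b S j * w j)"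
      by (simp only: x ln_x)
    then show ?thesis
      unfolding y_def by (simp add: b d_def W_def sum_distrib_left algebra_simps scaleR_conv_of_real)
  qed
  have cancel: "(\<Sum>S\<in>Pow {..<n}. sign_of S i * W S) = 2 ^ n * w i"
  proof -
    have "(\<Sum>S\<in>Pow {..<n}. sign_of S i * W S)
      = (\<Sum>j<n. (\<Sum>S\<in>Pow {..<n}. sign_of S i * sign_of S j) * w j)"
      by (simp add: W_def sum_distrib_left sum_distrib_right mult.assoc sum.swap[of _ "{..<n}"])
    also have "\<dots> = (\<Sum>j<n. (if i = j then 2 ^ n else 0) * w j)"
      using 2 by (simp add: sum_sign_of_mult cong: if_cong)
    also have "\<dots> = 2 ^ n * w i"
      by (subst sum_lessThan_single[OF 2(1)]) auto
    finally show ?thesis .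
  qed
  have "(\<Sum>S\<in>Pow {..<n}. sign_of S i * y S)
    = (\<Sum>S\<in>Pow {..<n}. of_real q * ((sign_of S i * sign_of S i) * d - sign_of S i * W S))"
    unfolding y by (intro sum.cong refl) (simp add: algebra_simps)
  also have "\<dots> = of_real q * ((\<Sum>S\<in>Pow {..<n}. sign_of S i * sign_of S i) * d
      - (\<Sum>S\<in>Pow {..<n}. sign_of S i * W S))"
    by (simp only: sum_distrib_left[symmetric] sum_subtractf sum_distrib_right)
  also have "\<dots> = of_real q * (2 ^ n * (v - c *\<^sub>R a i))"
    unfolding cancel using 2 by (simp add: sum_sign_of_mult v_def d_def algebra_simps)
  finally have avg: "norm (\<Sum>S\<in>Pow {..<n}. sign_of S i * y S) / 2 ^ n = q * norm (v - c *\<^sub>R a i)"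
    using q by (simp add: norm_mult norm_power)
  define Y where "Y = (\<Sum>S\<in>Pow {..<n}. norm (y S) powr p)"
  have "(q * norm (v - c *\<^sub>R a i)) powr p
    \<le> (\<Sum>S\<in>Pow {..<n}. norm (sign_of S i * y S) powr p) / 2 ^ n"
    using powr_norm_sum_le[of "Pow {..<n}" p "\<lambda>S. sign_of S i * y S"] p
    by (simp add: avg card_Pow Pow_not_empty)
  also have "\<dots> = Y / 2 ^ n"
    by (simp add: Y_def norm_mult)
  finally have "(q * norm (v - c *\<^sub>R a i)) powr p \<le> Y / 2 ^ n" .
  then have "norm (v - c *\<^sub>R a i) powr p / n \<le> Y / 2 ^ n"
    by (simp add: powr_mult q)
  then have lin: "norm (v - c *\<^sub>R a i) powr p \<le> n / 2 ^ n * Y"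
    using n by (simp add: pos_divide_le_eq mult.commute)
  have le: "norm v powr p \<le> (\<Sum>j<n. norm (ln (norm (a j)) *\<^sub>R a j - w j) powr p)"
    unfolding v_def
    by (rule member_le_sum[of i "{..<n}" "\<lambda>j. norm (ln (norm (a j)) *\<^sub>R a j - w j) powr p"])
      (use 2(1) in auto)
  have "(\<Sum>j<n. (c * norm (a j)) powr p) = (c * norm (a i)) powr p"
    by (rule sum_lessThan_single) (use 2 in auto)
  also have "\<dots> \<le> (norm v + norm (v - c *\<^sub>R a i)) powr p"
  proof (rule powr_mono2)
    have "norm (c *\<^sub>R a i) \<le> norm v + norm (v - c *\<^sub>R a i)"
      using norm_triangle_ineq4[of v "v - c *\<^sub>R a i"] by simp
    then show "c * norm (a i) \<le> norm v + norm (v - c *\<^sub>R a i)"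
      using c0 by simp
  qed (use p c0 in auto)
  also have "\<dots> \<le> 2 powr p * (norm v powr p + norm (v - c *\<^sub>R a i) powr p)"
    using p by (intro powr_add_le) auto
  also have "\<dots> \<le> 2 powr p * ((\<Sum>j<n. norm (ln (norm (a j)) *\<^sub>R a j - w j) powr p) + n / 2 ^ n * Y)"
    by (rule mult_left_mono[OF add_mono[OF le lin]]) simp
  finally show ?thesis
    unfolding c_def Y_def y_def .
qed

section \<open>Linear maps on spans\<close>

lemma span_ae_0: "(\<lambda>t. 0) \<in> span_ae M n u"
  by (auto simp: span_ae_def L0_def intro!: exI[of _ "\<lambda>_. 0"])

lemma span_ae_add:
  assumes "x \<in> span_ae M n u" "y \<in> span_ae M n u"
  shows "(\<lambda>t. x t + y t) \<in> span_ae M n u"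
proof -
  obtain c d where "AE t in M. x t = (\<Sum>i<n. c i * u i t)" "AE t in M. y t = (\<Sum>i<n. d i * u i t)"
    using assms by (auto simp: span_ae_def)
  then have "AE t in M. x t + y t = (\<Sum>i<n. (c i + d i) * u i t)"
    by eventually_elim (simp add: sum.distrib distrib_right)
  then show ?thesis
    using assms by (auto simp: span_ae_def L0_def)
qed

lemma span_ae_cmult:
  assumes "x \<in> span_ae M n u"
  shows "(\<lambda>t. a * x t) \<in> span_ae M n u"
proof -
  obtain c where "AE t in M. x t = (\<Sum>i<n. c i * u i t)"
    using assms by (auto simp: span_ae_def)
  then have "AE t in M. a * x t = (\<Sum>i<n. (a * c i) * u i t)"
    by eventually_elim (simp add: sum_distrib_left mult.assoc)
  then show ?thesis
    using assms by (auto simp: span_ae_def L0_def intro!: exI[of _ "\<lambda>i. a * c i"])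
qed

lemma span_ae_sum:
  fixes m :: nat
  assumes "\<And>i. i < m \<Longrightarrow> v i \<in> span_ae M n u"
  shows "(\<lambda>t. \<Sum>i<m. c i * v i t) \<in> span_ae M n u"
  using assms by (induction m) (auto intro!: span_ae_0 span_ae_add span_ae_cmult)

lemma span_ae_generator:
  assumes "i < n" "u i \<in> L0 M"
  shows "u i \<in> span_ae M n u"
proof -
  have "u i t = (\<Sum>j<n. (if j = i then 1 else 0) * u j t)" for t
    by (subst sum_lessThan_single[OF assms(1)]) auto
  then show ?thesis
    using assms by (auto simp: span_ae_def intro!: exI[of _ "\<lambda>j. if j = i then 1 else 0"])
qed

lemma linear_maps_L0_D:
  assumes "L \<in> linear_maps_L0 M E" "x \<in> E"
  shows linear_map_add: "y \<in> E \<Longrightarrow> AE t in M. L (\<lambda>s. x s + y s) t = L x t + L y t"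
    and linear_map_cmult: "AE t in M. L (\<lambda>s. a * x s) t = a * L x t"
  using assms by (auto simp: linear_maps_L0_def)

lemma linear_map_sum:
  fixes m :: nat
  assumes L: "L \<in> linear_maps_L0 M (span_ae M n u)"
    and "\<And>i. i < m \<Longrightarrow> v i \<in> span_ae M n u"
  shows "AE t in M. L (\<lambda>s. \<Sum>i<m. c i * v i s) t = (\<Sum>i<m. c i * L (v i) t)"
  using assms(2)
proof (induction m)
  case 0
  show ?case
    using linear_map_cmult[OF L span_ae_0, of 0] by simp
next
  case (Suc m)
  have v: "v m \<in> span_ae M n u" and sum: "(\<lambda>s. \<Sum>i<m. c i * v i s) \<in> span_ae M n u"
    using Suc.prems by (auto intro!: span_ae_sum)
  have "AE t in M. L (\<lambda>s. (\<Sum>i<m. c i * v i s) + c m * v m s) t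
      = L (\<lambda>s. \<Sum>i<m. c i * v i s) t + L (\<lambda>s. c m * v m s) t"
    by (rule linear_map_add[OF L sum span_ae_cmult[OF v]])
  moreover have "AE t in M. L (\<lambda>s. c m * v m s) t = c m * L (v m) t"
    by (rule linear_map_cmult[OF L v])
  moreover have "AE t in M. L (\<lambda>s. \<Sum>i<m. c i * v i s) t = (\<Sum>i<m. c i * L (v i) t)"
    using Suc by simp
  ultimately show ?case
    by eventually_elim simp
qed

section \<open>The lower bound for the modulus\<close>

text \<open>
  Integrating \<open>random_signs_pointwise\<close>: its left side contributes \<open>n (ln n / p) powr p\<close> and its
  right side at most \<open>2 powr p * (n B powr p + n B powr p)\<close>, because the vectors \<open>u i\<close> and their
  normalized sums with random signs are all unit vectors of the span.
\<close>

lemma kalton_peck_distance_to_linear: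
  fixes u :: "nat \<Rightarrow> 'a \<Rightarrow> 'k::{real_normed_field,euclidean_space}"
  assumes n: "0 < n" and p: "1 \<le> p"
    and u: "\<And>i. i < n \<Longrightarrow> u i \<in> Lp M p" "\<And>i. i < n \<Longrightarrow> Lp_norm M p (u i) = 1"
    and disj: "\<And>i j. i < n \<Longrightarrow> j < n \<Longrightarrow> i \<noteq> j \<Longrightarrow> AE t in M. u i t = 0 \<or> u j t = 0"
    and uE: "\<And>i. i < n \<Longrightarrow> u i \<in> span_ae M m e"
    and L: "L \<in> linear_maps_L0 M (span_ae M m e)"
    and B: "\<And>x. x \<in> span_ae M m e \<Longrightarrow> Lp_norm M p x \<le> 1 \<Longrightarrow>
        (\<lambda>t. kalton_peck M p x t - L x t) \<in> Lp M p \<and>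
        Lp_norm M p (\<lambda>t. kalton_peck M p x t - L x t) \<le> B"
  shows "ln n / p \<le> 4 * B"
proof -
  define b :: "nat set \<Rightarrow> nat \<Rightarrow> 'k"
    where "b S i = of_real (real n powr (- 1 / p)) * sign_of S i" for S i
  define x where "x S = (\<lambda>t. \<Sum>i<n. b S i * u i t)" for S
  define D where "D z = (\<lambda>t. kalton_peck M p z t - L z t)" for z
  have norm_b: "norm (b S i) powr p = 1 / n" for S i
    using n p by (simp add: b_def norm_mult norm_divide powr_divide powr_powr)
  have xE: "x S \<in> span_ae M m e" for S
    unfolding x_def by (intro span_ae_sum uE)
  have disj_ae: "AE t in M. \<forall>i\<in>{..<n}. \<forall>j\<in>{..<n}. i \<noteq> j \<longrightarrow> u i t = 0 \<or> u j t = 0"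
    by (intro AE_finite_allI) (use disj in auto)
  have int_u: "integrable M (\<lambda>t. norm (u i t) powr p)" "(\<integral>t. norm (u i t) powr p \<partial>M) = 1"
    if "i < n" for i
    using u(1)[OF that] u(2)[OF that] Lp_norm_powr[of p M "u i"] p by (auto simp: Lp_def)
  have norm_x: "Lp_norm M p (x S) = 1" for S
  proof -
    have [measurable]: "u i \<in> borel_measurable M" if "i < n" for i
      using u(1)[OF that] by (simp add: Lp_def L0_def)
    have "(\<integral>t. norm (x S t) powr p \<partial>M) = (\<integral>t. (\<Sum>i<n. 1 / n * norm (u i t) powr p) \<partial>M)"
    proof (rule integral_cong_AE)
      show "AE t in M. norm (x S t) powr p = (\<Sum>i<n. 1 / n * norm (u i t) powr p)"
        using disj_ae
      proof eventually_elim
        case (elim t)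
        then have "norm (x S t) powr p = (\<Sum>i<n. norm (b S i * u i t) powr p)"
          unfolding x_def by (intro powr_norm_disjoint_sum) auto
        then show ?case
          by (simp add: norm_mult powr_mult norm_b)
      qed
    qed (auto simp: x_def)
    also have "\<dots> = (\<Sum>i<n. 1 / n * (\<integral>t. norm (u i t) powr p \<partial>M))"
      using int_u by (subst Bochner_Integration.integral_sum) auto
    also have "\<dots> = 1"
      using int_u n by simp
    finally show ?thesis
      by (simp add: Lp_norm_def)
  qed
  have D: "integrable M (\<lambda>t. norm (D z t) powr p)" "(\<integral>t. norm (D z t) powr p \<partial>M) \<le> B powr p"
    if "z \<in> span_ae M m e" "Lp_norm M p z = 1" for z
  proof -
    have z: "D z \<in> Lp M p" "Lp_norm M p (D z) \<le> B"
      using B[of z] that by (auto simp: D_def)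
    then show "integrable M (\<lambda>t. norm (D z t) powr p)"
      by (simp add: Lp_def)
    have "Lp_norm M p (D z) powr p \<le> B powr p"
      using z p by (intro powr_mono2) auto
    then show "(\<integral>t. norm (D z t) powr p \<partial>M) \<le> B powr p"
      using p by (simp add: Lp_norm_powr)
  qed
  note D_u = D[OF uE u(2)] and D_x = D[OF xE norm_x]
  have "Lp_norm M p (D (u 0)) \<le> B"
    using B[OF uE[OF n]] u(2)[OF n] by (simp add: D_def)
  then have "0 \<le> B"
    by (rule order_trans[OF Lp_norm_nonneg])
  let ?l = "\<lambda>t. \<Sum>i<n. (ln n / p) powr p * norm (u i t) powr p"
  define U where "U t = (\<Sum>i<n. norm (D (u i) t) powr p)" for t
  define X where "X t = (\<Sum>S\<in>Pow {..<n}. norm (D (x S) t) powr p)" for t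
  let ?r = "\<lambda>t. 2 powr p * (U t + n / 2 ^ n * X t)"
  have L_x: "AE t in M. \<forall>S\<in>Pow {..<n}. L (x S) t = (\<Sum>i<n. b S i * L (u i) t)"
    by (intro AE_finite_allI) (auto simp: x_def intro: linear_map_sum[OF L uE])
  have U: "integrable M U" "(\<integral>t. U t \<partial>M) \<le> n * B powr p"
  proof -
    show "integrable M U"
      unfolding U_def using D_u by (intro Bochner_Integration.integrable_sum) auto
    have "(\<integral>t. U t \<partial>M) = (\<Sum>i<n. \<integral>t. norm (D (u i) t) powr p \<partial>M)"
      unfolding U_def using D_u by (intro Bochner_Integration.integral_sum) auto
    also have "\<dots> \<le> (\<Sum>i<n. B powr p)"
      using D_u by (intro sum_mono) auto
    finally show "(\<integral>t. U t \<partial>M) \<le> n * B powr p"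
      by simp
  qed
  have X: "integrable M X" "(\<integral>t. X t \<partial>M) \<le> 2 ^ n * B powr p"
  proof -
    show "integrable M X"
      unfolding X_def using D_x by (intro Bochner_Integration.integrable_sum) auto
    have "(\<integral>t. X t \<partial>M) = (\<Sum>S\<in>Pow {..<n}. \<integral>t. norm (D (x S) t) powr p \<partial>M)"
      unfolding X_def using D_x by (intro Bochner_Integration.integral_sum) auto
    also have "\<dots> \<le> (\<Sum>S\<in>Pow {..<n}. B powr p)"
      using D_x by (intro sum_mono) auto
    finally show "(\<integral>t. X t \<partial>M) \<le> 2 ^ n * B powr p"
      by (simp add: card_Pow)
  qed
  have "AE t in M. ?l t \<le> ?r t"
    using disj_ae L_x
  proof eventually_elim
    case (elim t)
    have D_ui: "ln (norm (u i t)) *\<^sub>R u i t - L (u i) t = D (u i) t" if "i < n" for i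
      using u(2)[OF that] by (simp add: D_def kalton_peck_def)
    have D_xS: "ln (norm (x S t)) *\<^sub>R x S t - (\<Sum>i<n. b S i * L (u i) t) = D (x S) t"
      if "S \<in> Pow {..<n}" for S
      using elim(2) that by (simp add: D_def kalton_peck_def norm_x)
    have "?l t = (\<Sum>i<n. (ln n / p * norm (u i t)) powr p)"
      by (simp only: powr_mult)
    also have "\<dots> \<le> 2 powr p * ((\<Sum>i<n. norm (ln (norm (u i t)) *\<^sub>R u i t - L (u i) t) powr p)
      + n / 2 ^ n * (\<Sum>S\<in>Pow {..<n}. norm (ln (norm (x S t)) *\<^sub>R x S t
          - (\<Sum>i<n. b S i * L (u i) t)) powr p))"
      unfolding x_def b_def
      by (rule random_signs_pointwise) (use elim n p in auto)
    also have "\<dots> = ?r t"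
      by (simp add: D_ui D_xS U_def X_def)
    finally show ?case .
  qed
  moreover have "integrable M ?l"
    using int_u by (intro Bochner_Integration.integrable_sum) auto
  moreover have "integrable M ?r"
    using U X by auto
  ultimately have "(\<integral>t. ?l t \<partial>M) \<le> (\<integral>t. ?r t \<partial>M)"
    by (intro integral_mono_AE)
  moreover have "(\<integral>t. ?l t \<partial>M) = n * (ln n / p) powr p"
    using int_u by (simp add: Bochner_Integration.integral_sum)
  ultimately have "n * (ln n / p) powr p \<le> (\<integral>t. ?r t \<partial>M)"
    by simp
  also have "\<dots> = 2 powr p * ((\<integral>t. U t \<partial>M) + n / 2 ^ n * (\<integral>t. X t \<partial>M))"
    using U X by simp
  also have "\<dots> \<le> 2 powr p * (n * B powr p + n / 2 ^ n * (2 ^ n * B powr p))"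
    using U X by (intro mult_left_mono add_mono) auto
  also have "\<dots> = n * (2 powr p * (2 * B powr p))"
    by simp
  finally have "n * (ln n / p) powr p \<le> n * (2 powr p * (2 * B powr p))" .
  then have "(ln n / p) powr p \<le> 2 powr p * (2 powr 1 * B powr p)"
    using n by simp
  also have "\<dots> \<le> 2 powr p * (2 powr p * B powr p)"
    using p by (intro mult_left_mono mult_right_mono powr_mono) auto
  also have "\<dots> = (2 * (2 * B)) powr p"
    by (simp only: powr_mult)
  finally have "(ln n / p) powr p \<le> (4 * B) powr p"
    by simp
  then show ?thesis
    using p \<open>0 \<le> B\<close> powr_less_mono2[of p "4 * B" "ln n / p"] by force
qed

lemma lin_indep_ae_nonzero:
  assumes "lin_indep_ae M n u" "i < n"
  shows "\<not> (AE t in M. u i t = 0)"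
proof
  assume "AE t in M. u i t = 0"
  moreover have "(\<Sum>j<n. (if j = i then 1 else 0) * u j t) = u i t" for t
    by (subst sum_lessThan_single[OF assms(2)]) auto
  ultimately have "AE t in M. (\<Sum>j<n. (if j = i then 1 else 0) * u j t) = 0"
    by simp
  then have "\<forall>j<n. (if j = i then 1 else 0 :: 'b) = 0"
    using assms(1)[unfolded lin_indep_ae_def, rule_format, of "\<lambda>j. if j = i then 1 else 0"] by blast
  then show False
    using assms(2) by auto
qed

lemma superdisjoint_modulus_kalton_peck_ge:
  assumes n: "0 < n" and p: "1 \<le> p"
  shows "ennreal (ln n / (4 * p)) \<le> superdisjoint_modulus M p
    (kalton_peck M p :: ('a \<Rightarrow> 'k::{real_normed_field,euclidean_space}) \<Rightarrow> 'a \<Rightarrow> 'k) n"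
  unfolding superdisjoint_modulus_def
proof (intro INF_greatest)
  fix E and L :: "('a \<Rightarrow> 'k) \<Rightarrow> 'a \<Rightarrow> 'k"
  assume "E \<in> disjoint_subspaces M p n" and L: "L \<in> linear_maps_L0 M E"
  then obtain u where E: "E = span_ae M n u" and u: "\<And>i. i < n \<Longrightarrow> u i \<in> Lp M p"
    and disj: "\<And>i j. i < n \<Longrightarrow> j < n \<Longrightarrow> i \<noteq> j \<Longrightarrow> AE t in M. u i t = 0 \<or> u j t = 0"
    and indep: "lin_indep_ae M n u"
    by (auto simp: disjoint_subspaces_def)
  let ?s = "SUP x\<in>{x \<in> E. Lp_norm M p x \<le> 1}. Lp_enorm M p (\<lambda>t. kalton_peck M p x t - L x t)"
  show "ennreal (ln n / (4 * p)) \<le> ?s"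
  proof (cases "?s = top")
    case False
    then obtain B where B: "0 \<le> B" "?s = ennreal B"
      by (cases ?s) auto
    have le: "(\<lambda>t. kalton_peck M p x t - L x t) \<in> Lp M p \<and>
        Lp_norm M p (\<lambda>t. kalton_peck M p x t - L x t) \<le> B" if "x \<in> E" "Lp_norm M p x \<le> 1" for x
    proof -
      have "Lp_enorm M p (\<lambda>t. kalton_peck M p x t - L x t) \<le> ennreal B"
        unfolding B(2)[symmetric] using that by (intro SUP_upper) auto
      then show ?thesis
        using B(1) by (auto simp: Lp_enorm_def top_unique split: if_splits)
    qed
    \<comment> \<open>Normalized generators: scaling keeps them disjoint and in the span, and linear independence
      keeps their norms from vanishing.\<close>
    define v where "v i = (\<lambda>t. of_real (1 / Lp_norm M p (u i)) * u i t)" for i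
    have pos: "0 < Lp_norm M p (u i)" if "i < n" for i
    proof -
      have "Lp_norm M p (u i) \<noteq> 0"
        using Lp_norm_eq_0_iff[OF u[OF that]] lin_indep_ae_nonzero[OF indep that] p by simp
      then show ?thesis
        by (simp add: less_le)
    qed
    have "ln n / p \<le> 4 * B"
    proof (rule kalton_peck_distance_to_linear[OF n p])
      fix i assume i: "i < n"
      show "v i \<in> Lp M p"
        unfolding v_def by (intro Lp_cmult u i)
      show "Lp_norm M p (v i) = 1"
        unfolding v_def using pos[OF i] p by (subst Lp_norm_cmult) (auto simp: norm_divide)
      show "v i \<in> span_ae M n u"
        unfolding v_def using u[OF i] i by (intro span_ae_cmult span_ae_generator) (auto simp: Lp_def)
    next
      fix i j assume "i < n" "j < n" "i \<noteq> j"
      from disj[OF this] show "AE t in M. v i t = 0 \<or> v j t = 0"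
        by (auto simp: v_def)
    qed (use L le in \<open>auto simp: E\<close>)
    then have "ln n / (4 * p) \<le> B"
      using p by (simp add: field_simps)
    then show ?thesis
      unfolding B(2) by (rule ennreal_leI)
  next
    case True
    then show ?thesis
      by (simp only: top_greatest)
  qed
qed

theorem proposition5p3:
  fixes M :: "'a measure" and p :: real
  assumes "sigma_finite_measure M"
    and "1 < p"
    and "infinite_dimensional_ae M (Lp M p :: ('a \<Rightarrow> 'k::{real_normed_field,euclidean_space}) set)"
  shows "super_disjointly_singular M p
           (kalton_peck M p :: ('a \<Rightarrow> 'k::{real_normed_field,euclidean_space}) \<Rightarrow> 'a \<Rightarrow> 'k)"
  unfolding super_disjointly_singular_def
proof
  show "centralizer M p (kalton_peck M p :: ('a \<Rightarrow> 'k) \<Rightarrow> 'a \<Rightarrow> 'k)"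
    using assms(2) by (intro centralizer_kalton_peck) auto
  have lim: "filterlim (\<lambda>n. ln (real n) / (4 * p)) at_top sequentially"
    using assms(2)
    by real_asymp
  show "superdisjoint_modulus M p (kalton_peck M p :: ('a \<Rightarrow> 'k) \<Rightarrow> 'a \<Rightarrow> 'k) \<longlonglongrightarrow> \<infinity>"
  proof (rule order_tendstoI)
    fix a :: ennreal
    assume "a < \<infinity>"
    then obtain r where r: "0 \<le> r" "a = ennreal r"
      by (cases a) auto
    have "eventually (\<lambda>n. r < ln (real n) / (4 * p)) sequentially"
      using lim by (simp add: filterlim_at_top_dense)
    then show "eventually (\<lambda>n. a < superdisjoint_modulus M p
        (kalton_peck M p :: ('a \<Rightarrow> 'k) \<Rightarrow> 'a \<Rightarrow> 'k) n) sequentially"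
      using eventually_gt_at_top[of 0]
    proof eventually_elim
      case (elim n)
      then have "a < ennreal (ln (real n) / (4 * p))"
        using r by (simp add: ennreal_less_iff)
      also have "\<dots> \<le> superdisjoint_modulus M p (kalton_peck M p :: ('a \<Rightarrow> 'k) \<Rightarrow> 'a \<Rightarrow> 'k) n"
        using elim assms(2) by (intro superdisjoint_modulus_kalton_peck_ge) auto
      finally show ?case .
    qed
  qed simp
qed

end
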